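(* Let $\mathcal{P}$ be a filtered poset, and let $B\colon\mathcal{P}\to\mathbb{N}$ be the labelling function of $\mathcal{P}$. Then $$\delta(\mathcal{P})\le\sup_{p\in\mathcal{P}}B(p).$$
   Context: A poset $\mathcal{P}$ is filtered if there is a strictly order-preserving map $d\colon\mathcal{P}\to\mathbb{N}$ (with $0\in\mathbb{N}$); one always takes $d(p)$ (the degree of $p$) to be the maximum length $n$ of a chain $p_0<\dots<p_n=p$ ending at $p$. Write $\mathcal{P}_{<p}$, $\mathcal{P}_{\le p}$, $\mathcal{P}_{\ge p}$ for the evident subposets, and $\prec$ for the cover relation. Labelling function. For $p\in\mathcal{P}$ and a subposet $S$ of $\mathcal{P}_{<p}$, $p$ closes a circuit in $S$ if some connected component of $S$ has at least two maximal elements. The labelling function $B\colon\mathcal{P}\to\mathbb{N}$ is defined inductively: $B(p)=0$ if $d(p)=0$, and $B(p)=1$ if $d(p)=1$. For $p$ of degree $\ge 2$, let $m=\max\{B(q)\mid q<p\}$ and $\mathcal{B}_p=\{s\in\mathcal{P}_{<p}\mid m-1\le B(s)\le m\}$; then $B(p)=m+1$ if $p$ closes a circuit in $\mathcal{B}_p$, and $B(p)=m$ otherwise. Measure. An element $p$ of a filtered poset $\mathcal{P}$ is unicovered if $\{q\in\mathcal{P}\mid p\prec q\}$ has exactly one element. For a filtered poset $\mathcal{P}$ with initial object $\hat 0$ and terminal object $\hat 1$, the measure $\mu(\mathcal{P})$ is defined inductively. First, $\mu(\mathcal{P})=0$ if and only if $\mathcal{P}$ has only one element. Now let $n>0$ and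 assume it has been defined what $\mu(\mathcal{P})\le n-1$ means. An $n$-sequence in $\mathcal{P}$ is a sequence of elements $p_1,p_2,\dots,p_k=\hat 0$, not necessarily ordered, such that for each $1\le i\le k$: (1) $p_i$ is unicovered in $\mathcal{P}\setminus\{p_1,\dots,p_{i-1}\}$; and (2) $\mu\big((\mathcal{P}\setminus\{p_1,\dots,p_{i-1}\})_{\le p_i}\big)\le n-1$. The measure $\mu(\mathcal{P})$ of a poset with more than one element is the smallest non-negative integer $n$ such that there exists an $n$-sequence in $\mathcal{P}$. For a filtered poset $\mathcal{P}$, $\delta(\mathcal{P})=\sup\{\mu(\mathcal{P}_{\ge q}\cap\mathcal{P}_{\le p})\mid q\le p\}$.
   Formalization: The supremum defining δ(P) is taken only over those intervals for which the measure μ is defined (some n-sequence exists); for infinite intervals μ may be undefined, e.g. 0 < a_i < 1 with infinitely many incomparable a_i, where sup B = 2. *)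

theory Defs
  imports Main "HOL-Library.Extended_Nat"
begin

text \<open>A poset is a set \<open>P\<close> of elements of a type of class \<open>order\<close>, with the induced order.
  Nothing is assumed to be finite.\<close>

definition filtered :: "'a::order set \<Rightarrow> bool" where
  "filtered P \<longleftrightarrow> (\<exists>d::'a \<Rightarrow> nat. \<forall>x\<in>P. \<forall>y\<in>P. x < y \<longrightarrow> d x < d y)"

text \<open>The length of the chain \<open>c 0 < \<dots> < c n\<close> is \<open>n\<close>.  In a filtered poset the lengths of the
  chains ending at \<open>p\<close> are bounded, so that the maximum exists.\<close>

definition chain_lengths :: "'a::order set \<Rightarrow> 'a \<Rightarrow> nat set" where
  "chain_lengths P p =
     {n. \<exists>c. (\<forall>i\<le>n. c i \<in> P) \<and> (\<forall>i<n. c i < c (Suc i)) \<and> c n = p}"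

definition degree :: "'a::order set \<Rightarrow> 'a \<Rightarrow> nat" where
  "degree P p = Max (chain_lengths P p)"

definition comparability :: "'a::order set \<Rightarrow> ('a \<times> 'a) set" where
  "comparability S = {(x, y). x \<in> S \<and> y \<in> S \<and> (x \<le> y \<or> y \<le> x)}"

definition components :: "'a::order set \<Rightarrow> 'a set set" where
  "components S = {{y \<in> S. (x, y) \<in> (comparability S)\<^sup>*} | x. x \<in> S}"

definition maximal_elements :: "'a::order set \<Rightarrow> 'a set" where
  "maximal_elements C = {x \<in> C. \<not> (\<exists>y\<in>C. x < y)}"

definition closes_circuit :: "'a::order set \<Rightarrow> 'a \<Rightarrow> 'a set \<Rightarrow> bool" where
  "closes_circuit P p S \<longleftrightarrow> S \<subseteq> {q \<in> P. q < p} \<and>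
     (\<exists>C\<in>components S. \<exists>x\<in>maximal_elements C. \<exists>y\<in>maximal_elements C. x \<noteq> y)"

text \<open>The labelling function is defined by well-founded recursion along the strict order of \<open>P\<close>;
  its recursion equation, for filtered \<open>P\<close>, is \<open>label_eq\<close> below.  In the last case
  \<open>p\<close> has degree at least 2, so that some \<open>q < p\<close> has degree at least 1; hence \<open>m \<ge> 1\<close> and the
  subtraction \<open>m - 1\<close> is not truncated.  The maximum exists by \<open>finite_labels_below\<close>.\<close>

definition label_step :: "'a::order set \<Rightarrow> ('a \<Rightarrow> nat) \<Rightarrow> 'a \<Rightarrow> nat" where
  "label_step P B p =
     (if degree P p = 0 then 0
      else if degree P p = 1 then 1
      else let m = Max (B ` {q \<in> P. q < p}) in
        if closes_circuit P p {s \<in> P. s < p \<and> m - 1 \<le> B s \<and> B s \<le> m} then m + 1 else m)"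

definition label :: "'a::order set \<Rightarrow> 'a \<Rightarrow> nat" where
  "label P = wfrec {(q, p). q \<in> P \<and> p \<in> P \<and> q < p} (label_step P)"

lemma wf_filtered:
  assumes "filtered P"
  shows "wf {(q, p). q \<in> P \<and> p \<in> P \<and> q < p}"
proof -
  obtain d :: "'a \<Rightarrow> nat" where "\<forall>x\<in>P. \<forall>y\<in>P. x < y \<longrightarrow> d x < d y"
    using assms by (auto simp: filtered_def)
  then have "{(q, p). q \<in> P \<and> p \<in> P \<and> q < p} \<subseteq> measure d" by auto
  then show ?thesis by (rule wf_subset[OF wf_measure])
qed

lemma label_eq:
  assumes "filtered P" "p \<in> P"
  shows "label P p =
     (if degree P p = 0 then 0
      else if degree P p = 1 then 1
      else let m = Max (label P ` {q \<in> P. q < p}) in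
        if closes_circuit P p {s \<in> P. s < p \<and> m - 1 \<le> label P s \<and> label P s \<le> m}
        then m + 1 else m)"
proof -
  let ?R = "{(q, p). q \<in> P \<and> p \<in> P \<and> q < p}"
  have "label P p = label_step P (cut (label P) ?R p) p"
    unfolding label_def by (rule wfrec[OF wf_filtered[OF assms(1)]])
  moreover have "cut (label P) ?R p ` {q \<in> P. q < p} = label P ` {q \<in> P. q < p}"
    using assms(2) by (intro image_cong) (auto simp: cut_apply)
  moreover have "{s \<in> P. s < p \<and> m - 1 \<le> cut (label P) ?R p s \<and> cut (label P) ?R p s \<le> m} =
      {s \<in> P. s < p \<and> m - 1 \<le> label P s \<and> label P s \<le> m}" for m
    using assms(2) by (auto simp: cut_apply)
  ultimately show ?thesis by (simp add: label_step_def)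
qed

lemma finite_chain_lengths:
  assumes "filtered P"
  shows "finite (chain_lengths P p)"
proof -
  obtain d :: "'a \<Rightarrow> nat" where d: "\<forall>x\<in>P. \<forall>y\<in>P. x < y \<longrightarrow> d x < d y"
    using assms by (auto simp: filtered_def)
  have "n \<le> d p" if "n \<in> chain_lengths P p" for n
  proof -
    obtain c where c: "\<forall>i\<le>n. c i \<in> P" "\<forall>i<n. c i < c (Suc i)" "c n = p"
      using \<open>n \<in> chain_lengths P p\<close> by (auto simp: chain_lengths_def)
    have "i \<le> n \<Longrightarrow> i \<le> d (c i)" for i
    proof (induction i)
      case (Suc i)
      then have "d (c i) < d (c (Suc i))" using c d by simp
      with Suc show ?case by simp
    qed simp
    then show ?thesis using c(3) by auto
  qed
  then show ?thesis by (auto simp: finite_nat_set_iff_bounded_le)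
qed

lemma degree_less:
  assumes "filtered P" "q \<in> P" "p \<in> P" "q < p"
  shows "degree P q < degree P p"
proof -
  have "0 \<in> chain_lengths P q" using assms(2) by (auto simp: chain_lengths_def)
  then have "degree P q \<in> chain_lengths P q"
    using finite_chain_lengths[OF assms(1)] unfolding degree_def by (intro Max_in) auto
  then obtain c where c: "\<forall>i\<le>degree P q. c i \<in> P" "\<forall>i<degree P q. c i < c (Suc i)"
      "c (degree P q) = q"
    by (auto simp: chain_lengths_def)
  have "Suc (degree P q) \<in> chain_lengths P p"
    unfolding chain_lengths_def using c assms
    by (intro CollectI exI[of _ "c(Suc (degree P q) := p)"]) (auto simp: le_Suc_eq less_Suc_eq)
  then have "Suc (degree P q) \<le> degree P p"
    using finite_chain_lengths[OF assms(1)] unfolding degree_def by (intro Max_ge) auto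
  then show ?thesis by simp
qed

lemma label_le_degree:
  assumes "filtered P" "p \<in> P"
  shows "label P p \<le> degree P p"
  using assms(2)
proof (induction "degree P p" arbitrary: p rule: less_induct)
  case less
  let ?L = "label P ` {q \<in> P. q < p}"
  have below: "l < degree P p" if "l \<in> ?L" for l
    using that less degree_less[OF assms(1)] by (fastforce dest: le_less_trans)
  show ?case
  proof (cases "degree P p \<le> 1")
    case True
    then show ?thesis by (subst label_eq[OF assms(1) less.prems]) (auto simp: le_Suc_eq)
  next
    case False
    have "finite ?L" using below by (auto simp: finite_nat_set_iff_bounded)
    have "degree P p \<in> chain_lengths P p"
      using finite_chain_lengths[OF assms(1)] less.prems unfolding degree_def
      by (intro Max_in) (auto simp: chain_lengths_def)
    then obtain c where c: "\<forall>i\<le>degree P p. c i \<in> P" "\<forall>i<degree P p. c i < c (Suc i)"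
        "c (degree P p) = p"
      by (auto simp: chain_lengths_def)
    then have "c (degree P p - 1) \<in> {q \<in> P. q < p}"
      using False c(2)[rule_format, of "degree P p - 1"] by simp
    then have "Max ?L < degree P p"
      using below \<open>finite ?L\<close> by (subst Max_less_iff) auto
    then show ?thesis
      using False by (subst label_eq[OF assms(1) less.prems]) (auto simp: Let_def)
  qed
qed

lemma finite_labels_below:
  assumes "filtered P" "p \<in> P"
  shows "finite (label P ` {q \<in> P. q < p})"
proof -
  have "label P q < degree P p" if "q \<in> P" "q < p" for q
    using label_le_degree[OF assms(1) that(1)] degree_less[OF assms(1) that(1) assms(2) that(2)]
    by simp
  then show ?thesis by (auto simp: finite_nat_set_iff_bounded)
qed

definition covers :: "'a::order set \<Rightarrow> 'a \<Rightarrow> 'a set" where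
  "covers P p = {q \<in> P. p < q \<and> \<not> (\<exists>r\<in>P. p < r \<and> r < q)}"

definition unicovered :: "'a::order set \<Rightarrow> 'a \<Rightarrow> bool" where
  "unicovered P p \<longleftrightarrow> p \<in> P \<and> (\<exists>!q. q \<in> covers P p)"

definition initial :: "'a::order set \<Rightarrow> 'a \<Rightarrow> bool" where
  "initial P z \<longleftrightarrow> z \<in> P \<and> (\<forall>x\<in>P. z \<le> x)"

text \<open>The sequence \<open>p\<^sub>1, \<dots>, p\<^sub>k\<close> is the list \<open>ps\<close>, and the argument \<open>M\<close> stands for the
  property of having measure at most \<open>n - 1\<close>, which is already defined when \<open>n\<close>-sequences are.\<close>

definition sequence_wrt :: "('a::order set \<Rightarrow> bool) \<Rightarrow> 'a set \<Rightarrow> 'a list \<Rightarrow> bool" where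
  "sequence_wrt M P ps \<longleftrightarrow> ps \<noteq> [] \<and> initial P (last ps) \<and>
     (\<forall>i<length ps. unicovered (P - set (take i ps)) (ps ! i) \<and>
        M {x \<in> P - set (take i ps). x \<le> ps ! i})"

primrec measure_le :: "nat \<Rightarrow> 'a::order set \<Rightarrow> bool" where
  "measure_le 0 P \<longleftrightarrow> is_singleton P"
| "measure_le (Suc n) P \<longleftrightarrow> measure_le n P \<or> (\<exists>ps. sequence_wrt (measure_le n) P ps)"

definition n_sequence :: "nat \<Rightarrow> 'a::order set \<Rightarrow> 'a list \<Rightarrow> bool" where
  "n_sequence n P ps \<longleftrightarrow> n > 0 \<and> sequence_wrt (measure_le (n - 1)) P ps"

text \<open>An infinite poset with initial and terminal object need not have an \<open>n\<close>-sequence for any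
  \<open>n\<close>; its measure is then not defined in \<open>\<nat>\<close>, and the infimum below is \<open>\<infinity>\<close>.\<close>

definition poset_measure :: "'a::order set \<Rightarrow> enat" where
  "poset_measure P =
     (if is_singleton P then 0 else Inf {enat n | n. \<exists>ps. n_sequence n P ps})"

lemma measure_le_iff_n_sequence:
  "measure_le n P \<longleftrightarrow> is_singleton P \<or> (\<exists>k\<le>n. \<exists>ps. n_sequence k P ps)"
proof (induction n)
  case (Suc n)
  have "(\<exists>ps. sequence_wrt (measure_le n) P ps) \<longleftrightarrow> (\<exists>ps. n_sequence (Suc n) P ps)"
    by (simp add: n_sequence_def)
  with Suc show ?case unfolding measure_le.simps le_Suc_eq by blast
qed (simp add: n_sequence_def)

lemma poset_measure_le_iff: "poset_measure P \<le> enat n \<longleftrightarrow> measure_le n P"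
proof (cases "is_singleton P")
  case False
  let ?A = "{enat n | n. \<exists>ps. n_sequence n P ps}"
  have "Inf ?A \<le> enat n \<longleftrightarrow> (\<exists>k\<le>n. \<exists>ps. n_sequence k P ps)"
  proof
    assume le: "Inf ?A \<le> enat n"
    then have "?A \<noteq> {}" by (metis Inf_empty enat_ord_code(5) top_enat_def)
    then have "Inf ?A \<in> ?A"
      unfolding Inf_enat_def by (metis (no_types, lifting) LeastI equals0I)
    with le show "\<exists>k\<le>n. \<exists>ps. n_sequence k P ps" by auto
  next
    assume "\<exists>k\<le>n. \<exists>ps. n_sequence k P ps"
    then show "Inf ?A \<le> enat n" by (force intro: Inf_lower2)
  qed
  with False show ?thesis by (simp add: poset_measure_def measure_le_iff_n_sequence)
qed (simp add: poset_measure_def measure_le_iff_n_sequence zero_enat_def)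

text \<open>The supremum ranges over the intervals whose measure is defined.  If every interval has a
  measure (for instance if every interval is finite), these are all intervals.\<close>

definition delta :: "'a::order set \<Rightarrow> enat" where
  "delta P = Sup {poset_measure {x \<in> P. q \<le> x \<and> x \<le> p} | q p.
     q \<in> P \<and> p \<in> P \<and> q \<le> p \<and> poset_measure {x \<in> P. q \<le> x \<and> x \<le> p} \<noteq> \<infinity>}"

end

theory Submission imports Defs
begin

text \<open>
  Let \<open>B\<close> be the labelling function and fix an interval \<open>I = [q, p]\<close> with \<open>q < p\<close> and \<open>n = B p\<close>.
  The function \<open>B\<close> is monotone, and the circuit condition restricts how elements with the
  two highest labels \<open>n - 1\<close> and \<open>n\<close> can sit below \<open>p\<close>: if \<open>t\<close> has label \<open>n\<close>, then
  \<open>t\<close> is comparable to every \<open>u\<close> with which it has a common lower bound of label at least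
  \<open>n - 1\<close> (\<open>top_label_comparable\<close>).  Indeed, if \<open>u\<close> and \<open>t\<close> differ from \<open>p\<close>,
  then the label \<open>n\<close> occurs below \<open>p\<close>, hence \<open>p\<close> closes no circuit, and \<open>u\<close> and \<open>t\<close> have a common
  upper bound strictly below \<open>p\<close>.  It has label \<open>n\<close> too, so one can descend until it is \<open>u\<close> or \<open>t\<close>.

  If \<open>I\<close> is finite, an \<open>n\<close>-sequence therefore arises as follows.
  \<^enum> Remove the elements of label \<open>n - 1\<close>, larger ones first.  What remains above such an element
    is a chain, and nothing below it has been removed, so condition (2) is the
    induction hypothesis for a smaller interval.
  \<^enum> Remove the elements \<open>t \<noteq> p\<close> of label \<open>n\<close>, smaller ones first.  Above \<open>t\<close> there is a chain. Below
    \<open>t\<close> only labels up to \<open>n - 2\<close> are left, and removing these, larger ones first, is an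
    \<open>(n - 1)\<close>-sequence (\<open>sequence_low_labels\<close>).
  \<^enum> Remove the elements of label at most \<open>n - 2\<close>, larger ones first; each is covered by \<open>p\<close> alone.

  The process stops once \<open>q\<close> is removed, whichever stage that happens in.

  An infinite interval can have a measure too, and the bound must hold for it as well.  The set
  \<open>R\<close> of all elements occurring in a sequence is finite, and above each \<open>x \<in> R\<close> the complement
  \<open>I - R\<close> has a least element: follow the unique covers until they leave \<open>R\<close>
  (\<open>removal_list_strippable\<close>).  This property of \<open>R\<close>, called strippability, forgets the order of
  the removals, passes to the intervals \<open>[q, x]\<close>, and is all that the three stages need when they
  are carried out with the elements of \<open>R\<close> only.  So any sequence can be rearranged into an
  \<open>n\<close>-sequence (\<open>measure_le_label\<close>); the finite case is \<open>R = I - {p}\<close>.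
\<close>

section \<open>Lists of removals and strippable sets\<close>

definition least_above :: "'a::order set \<Rightarrow> 'a \<Rightarrow> 'a \<Rightarrow> bool" where
  "least_above S x z \<longleftrightarrow> z \<in> S \<and> x < z \<and> (\<forall>y\<in>S. x < y \<longrightarrow> z \<le> y)"

lemma least_above_unicovered:
  assumes "x \<in> S" "least_above S x z"
  shows "unicovered S x"
proof -
  have "covers S x = {z}"
    using assms by (fastforce simp: covers_def least_above_def)
  then show ?thesis using assms(1) by (simp add: unicovered_def)
qed

lemma filtered_subset: "filtered P \<Longrightarrow> S \<subseteq> P \<Longrightarrow> filtered S"
  unfolding filtered_def by blast

lemma filtered_minimal:
  assumes "filtered P" "S \<subseteq> P" "x \<in> S"
  obtains z where "z \<in> S" "\<And>y. y \<in> S \<Longrightarrow> \<not> y < z"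
proof -
  obtain z where "z \<in> S" "\<And>y. (y, z) \<in> {(q, p). q \<in> P \<and> p \<in> P \<and> q < p} \<Longrightarrow> y \<notin> S"
    by (rule wfE_min[OF wf_filtered[OF assms(1)] assms(3)]) blast
  with that show ?thesis using assms(2) by blast
qed

text \<open>Below any element above \<open>x\<close> there is a cover of \<open>x\<close>, because a filtered poset is well-founded.\<close>

lemma unicovered_least_above:
  assumes "filtered S" "unicovered S x"
  obtains z where "least_above S x z"
proof -
  obtain z where z: "z \<in> covers S x" "\<And>y. y \<in> covers S x \<Longrightarrow> y = z"
    using assms(2) unfolding unicovered_def by blast
  have "z \<le> y" if y: "y \<in> S" "x < y" for y
  proof -
    obtain w where w: "w \<in> {w \<in> S. x < w \<and> w \<le> y}"
        "\<And>v. v \<in> {w \<in> S. x < w \<and> w \<le> y} \<Longrightarrow> \<not> v < w"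
      using filtered_minimal[OF assms(1), of "{w \<in> S. x < w \<and> w \<le> y}" y] y by auto
    then have "w \<in> covers S x"
      unfolding covers_def by (auto dest: less_imp_le order_trans)
    with z(2) w(1) show ?thesis by blast
  qed
  then have "least_above S x z" using z(1) by (simp add: least_above_def covers_def)
  with that show ?thesis .
qed

lemma least_above_of_chain:
  assumes "filtered S" "y \<in> S" "x < y"
    and "\<And>u v. u \<in> S \<Longrightarrow> v \<in> S \<Longrightarrow> x < u \<Longrightarrow> x < v \<Longrightarrow> u \<le> v \<or> v \<le> u"
  shows "\<exists>z. least_above S x z"
proof -
  obtain z where z: "z \<in> {z \<in> S. x < z}" "\<And>v. v \<in> {z \<in> S. x < z} \<Longrightarrow> \<not> v < z"
    using filtered_minimal[OF assms(1), of "{z \<in> S. x < z}" y] assms(2,3) by auto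
  then have "least_above S x z"
    unfolding least_above_def using assms(4) by (fastforce simp: order_le_less)
  then show ?thesis ..
qed

text \<open>The order-free trace of a list of removals: if the elements of \<open>R\<close> are removed from \<open>I\<close> with
  larger ones first, then each is unicovered at its turn.\<close>

definition strippable :: "'a::order set \<Rightarrow> 'a set \<Rightarrow> bool" where
  "strippable I R \<longleftrightarrow> finite R \<and> R \<subseteq> I \<and> (\<forall>x\<in>R. \<exists>z. least_above (I - R) x z)"

text \<open>If the unique cover \<open>z\<close> of the first element \<open>x\<close> is itself removed later, then everything
  above \<open>x\<close> lies above \<open>z\<close>, so the least remaining element above \<open>z\<close> also serves \<open>x\<close>.\<close>

lemma removal_list_strippable:
  assumes "filtered I"
    and "\<forall>i<length ps. unicovered (I - set (take i ps)) (ps ! i)"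
  shows "strippable I (set ps)"
  using assms
proof (induction ps arbitrary: I)
  case Nil
  then show ?case by (simp add: strippable_def)
next
  case (Cons x ps)
  have uni: "unicovered I x" using Cons.prems(2) by force
  have "unicovered ((I - {x}) - set (take i ps)) (ps ! i)" if "i < length ps" for i
    using Cons.prems(2)[rule_format, of "Suc i"] that by (simp add: Diff_insert2[of I x "set (take i ps)"])
  then have strip: "strippable (I - {x}) (set ps)"
    using Cons.IH[OF filtered_subset[OF Cons.prems(1)]] by blast
  have rest: "I - {x} - set ps = I - set (x # ps)" by auto
  obtain z where z: "least_above I x z"
    using unicovered_least_above[OF Cons.prems(1) uni] .
  have "\<exists>z. least_above (I - set (x # ps)) x z"
  proof (cases "z \<in> set ps")
    case False
    with z show ?thesis by (auto simp: least_above_def intro!: exI[of _ z])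
  next
    case True
    then obtain w where "least_above (I - set (x # ps)) z w"
      using strip rest unfolding strippable_def by metis
    with z True show ?thesis
      by (auto simp: least_above_def order_le_less intro!: exI[of _ w])
  qed
  with strip rest uni show ?case
    unfolding strippable_def by (auto simp: unicovered_def)
qed

text \<open>The least element of \<open>I - R\<close> above \<open>w\<close> still serves \<open>w\<close> if it lies below \<open>x\<close>; otherwise
  nothing between \<open>w\<close> and \<open>x\<close> survives, and \<open>x\<close> itself takes its place.\<close>

lemma strippable_below:
  assumes "strippable I R" "x \<in> I"
  shows "strippable {y \<in> I. y \<le> x} {y \<in> R. y < x}"
proof -
  let ?I = "{y \<in> I. y \<le> x}" and ?R = "{y \<in> R. y < x}"
  have "\<exists>z. least_above (?I - ?R) w z" if w: "w \<in> ?R" for w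
  proof -
    obtain z where z: "least_above (I - R) w z"
      using assms(1) w unfolding strippable_def by blast
    show ?thesis
    proof (cases "z \<le> x")
      case True
      then have "least_above (?I - ?R) w z"
        using z by (auto simp: least_above_def)
      then show ?thesis ..
    next
      case False
      have "y = x" if "y \<in> ?I - ?R" "w < y" for y
        using that False z by (auto simp: least_above_def intro: order_trans)
      then have "least_above (?I - ?R) w x"
        using w assms(2) by (auto simp: least_above_def)
      then show ?thesis ..
    qed
  qed
  then show ?thesis using assms(1) by (auto simp: strippable_def)
qed

section \<open>Building sequences\<close>

lemma measure_le_mono:
  assumes "measure_le k P" "k \<le> n"
  shows "measure_le n P"
  using assms(2,1) by (induction n rule: dec_induct) auto

lemma sequence_wrt_mono:
  assumes "sequence_wrt M P ps" "\<And>S. M S \<Longrightarrow> N S"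
  shows "sequence_wrt N P ps"
  using assms unfolding sequence_wrt_def by blast

text \<open>Both conditions on one entry of a sequence, with unicoveredness replaced by the existence of
  a least element above, which is equivalent to it in filtered posets.\<close>

definition removable :: "('a::order set \<Rightarrow> bool) \<Rightarrow> 'a set \<Rightarrow> 'a \<Rightarrow> bool" where
  "removable M I x \<longleftrightarrow> x \<in> I \<and> (\<exists>z. least_above I x z) \<and> M {y \<in> I. y \<le> x}"

text \<open>The alternative \<open>x = q\<close> allows a sequence to end as soon as the initial element can go,
  leaving other elements in place.\<close>

lemma sequence_wrt_Cons:
  assumes "initial I q" "removable M I x" "x = q \<or> (\<exists>ps. sequence_wrt M (I - {x}) ps)"
  shows "\<exists>ps. sequence_wrt M I ps"
proof (cases "x = q")
  case True
  then have "sequence_wrt M I [q]"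
    using assms(1,2) least_above_unicovered by (auto simp: sequence_wrt_def removable_def)
  then show ?thesis ..
next
  case False
  then obtain ps where ps: "sequence_wrt M (I - {x}) ps" using assms(3) by blast
  then have "initial I (last ps)"
    using assms(1) False unfolding sequence_wrt_def initial_def by (metis DiffD1 DiffI empty_iff insert_iff order_trans)
  moreover have "unicovered I x" "M {y \<in> I. y \<le> x}"
    using assms(2) least_above_unicovered unfolding removable_def by blast+
  moreover have rest: "I - insert x (set (take i ps)) = I - {x} - set (take i ps)" for i
    by (rule Diff_insert2)
  ultimately have "sequence_wrt M I (x # ps)"
    using ps unfolding sequence_wrt_def
    by (simp add: All_less_Suc2 rest)
  then show ?thesis ..
qed

text \<open>The elements of \<open>A\<close> are removed in an order that extends \<open>before\<close>.  The set \<open>D\<close>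
  is what has been removed when \<open>x\<close> has its turn: all elements of \<open>A\<close> that come before \<open>x\<close>, none that come
  after it, and any choice of the others.  If \<open>q \<in> A\<close>, the sequence ends with \<open>q\<close>; if not, a sequence
  in the rest \<open>I - A\<close> is appended.\<close>

lemma sequence_wrt_peel:
  assumes "finite A" "transp before" "asymp before" "initial I q"
    and "\<And>x D. x \<in> A \<Longrightarrow> D \<subseteq> A - {x} \<Longrightarrow> (\<And>y. y \<in> A \<Longrightarrow> before y x \<Longrightarrow> y \<in> D) \<Longrightarrow>
           (\<And>y. y \<in> D \<Longrightarrow> \<not> before x y) \<Longrightarrow> removable M (I - D) x"
    and "q \<in> A \<or> (\<exists>ps. sequence_wrt M (I - A) ps)"
  shows "\<exists>ps. sequence_wrt M I ps"
  using assms(1,4-)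
proof (induction "card A" arbitrary: A I)
  case 0
  then show ?case by simp
next
  case (Suc n)
  then have "A \<noteq> {}" by auto
  then obtain x where x: "x \<in> A" "\<And>y. y \<in> A \<Longrightarrow> \<not> before y x"
    using Finite_Set.bex_min_element[OF Suc.prems(1), of before] assms(2,3)
    by (metis asympD asymp_on_subset top_greatest transp_on_subset)
  have "removable M (I - {}) x"
    by (rule Suc.prems(3)) (use x in auto)
  then have rem: "removable M I x" by simp
  show ?case
  proof (cases "x = q")
    case True
    then show ?thesis using sequence_wrt_Cons[OF Suc.prems(2) rem] by blast
  next
    case False
    have "\<exists>ps. sequence_wrt M (I - {x}) ps"
    proof (rule Suc.hyps(1)[of "A - {x}"])
      show "n = card (A - {x})" using Suc.hyps(2) x(1) by simp
      show "finite (A - {x})" using Suc.prems(1) by simp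
      show "initial (I - {x}) q" using Suc.prems(2) False by (auto simp: initial_def)
      show "q \<in> A - {x} \<or> (\<exists>ps. sequence_wrt M (I - {x} - (A - {x})) ps)"
      proof -
        have "I - {x} - (A - {x}) = I - A" using x(1) by auto
        then show ?thesis using Suc.prems(4) False by auto
      qed
      fix y D
      assume y: "y \<in> A - {x}" "D \<subseteq> A - {x} - {y}"
        "\<And>w. w \<in> A - {x} \<Longrightarrow> before w y \<Longrightarrow> w \<in> D" "\<And>w. w \<in> D \<Longrightarrow> \<not> before y w"
      have "removable M (I - insert x D) y"
        by (rule Suc.prems(3)) (use x y in auto)
      then show "removable M (I - {x} - D) y" by (simp only: Diff_insert2[of I x D])
    qed
    then show ?thesis using sequence_wrt_Cons[OF Suc.prems(2) rem] by blast
  qed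
qed

section \<open>The labelling function\<close>

lemma label_mono:
  assumes "filtered P" "q \<in> P" "p \<in> P" "q \<le> p"
  shows "label P q \<le> label P p"
proof (cases "q = p")
  case False
  then have "q < p" using assms(4) by simp
  then have deg: "degree P q < degree P p" using degree_less assms by blast
  show ?thesis
  proof (cases "degree P p = 1")
    case True
    then show ?thesis using label_le_degree[OF assms(1,2)] deg by simp
  next
    case False
    have "label P q \<le> Max (label P ` {q \<in> P. q < p})"
      using finite_labels_below[OF assms(1,3)] \<open>q < p\<close> assms(2) by (intro Max_ge) auto
    then show ?thesis
      using False deg unfolding label_eq[OF assms(1,3)] by (auto simp: Let_def)
  qed
qed simp

text \<open>In degree at least 2, a chain below \<open>p\<close> contains an element that has another one below it,
  so that monotonicity applies.\<close>

lemma label_pos: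
  assumes "filtered P" "q \<in> P" "p \<in> P" "q < p"
  shows "0 < label P p"
  using assms(2-)
proof (induction "degree P p" arbitrary: q p rule: less_induct)
  case less
  have deg: "degree P q < degree P p" using degree_less[OF assms(1)] less.prems by blast
  show ?case
  proof (cases "degree P p = 1")
    case True
    then show ?thesis by (subst label_eq[OF assms(1) less.prems(2)]) simp
  next
    case False
    have "degree P p \<in> chain_lengths P p"
      using finite_chain_lengths[OF assms(1)] less.prems unfolding degree_def
      by (intro Max_in) (auto simp: chain_lengths_def)
    then obtain c where c: "\<forall>i\<le>degree P p. c i \<in> P" "\<forall>i<degree P p. c i < c (Suc i)"
        "c (degree P p) = p"
      by (auto simp: chain_lengths_def)
    obtain n where n: "degree P p = Suc (Suc n)"
      using False deg by (metis One_nat_def gr_implies_not0 not0_implies_Suc)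
    then have "c n \<in> P" "c (Suc n) \<in> P" "c n < c (Suc n)" "c (Suc n) < p"
      using c by (metis le_Suc_eq lessI less_Suc_eq nle_le)+
    then have "0 < label P (c (Suc n))" "label P (c (Suc n)) \<le> label P p"
      using less.hyps[OF degree_less[OF assms(1)]] less.prems(2) label_mono[OF assms(1)]
      by (auto simp: less_imp_le)
    then show ?thesis by simp
  qed
qed

text \<open>The elements \<open>u\<close> and \<open>v\<close> lie in the component of \<open>x\<close>, and each of them is below a maximal
  element of it, since degrees below \<open>p\<close> are bounded.  Without a circuit there is only one.\<close>

lemma not_closes_circuit_bounded:
  assumes "filtered P" "p \<in> P" "S \<subseteq> {q \<in> P. q < p}" "\<not> closes_circuit P p S"
    and "x \<in> S" "u \<in> S" "v \<in> S" "x \<le> u" "x \<le> v"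
  obtains w where "w \<in> S" "u \<le> w" "v \<le> w"
proof -
  let ?C = "{y \<in> S. (x, y) \<in> (comparability S)\<^sup>*}"
  have C: "?C \<in> components S" using assms(5) by (auto simp: components_def)
  have closed: "b \<in> ?C" if "a \<in> ?C" "b \<in> S" "a \<le> b" for a b
    using that by (auto simp: comparability_def intro: rtrancl_into_rtrancl)
  have max: "\<exists>w\<in>maximal_elements ?C. a \<le> w" if a: "a \<in> S" "x \<le> a" for a
  proof -
    let ?D = "{w \<in> S. a \<le> w}"
    have "degree P w < degree P p" if "w \<in> ?D" for w
      using that assms(3) degree_less[OF assms(1) _ assms(2)] by blast
    then have fin: "finite (degree P ` ?D)" by (auto simp: finite_nat_set_iff_bounded)
    have "Max (degree P ` ?D) \<in> degree P ` ?D"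
      by (intro Max_in fin) (use a in auto)
    then obtain w where w: "w \<in> ?D" "degree P w = Max (degree P ` ?D)" by auto
    have "\<not> w < y" if y: "y \<in> S" for y
    proof
      assume "w < y"
      then have "degree P w < degree P y" "y \<in> ?D"
        using degree_less[OF assms(1)] w(1) y assms(3) by (auto dest: order.strict_trans1)
      then show False using w(2) Max_ge[OF fin, of "degree P y"] by auto
    qed
    moreover have "w \<in> ?C"
      using closed[of x w] w(1) a assms(5) by auto
    ultimately show ?thesis using w(1) by (auto simp: maximal_elements_def)
  qed
  obtain w1 w2 where w: "w1 \<in> maximal_elements ?C" "u \<le> w1" "w2 \<in> maximal_elements ?C" "v \<le> w2"
    using max assms(6-) by blast
  then have "w1 = w2" using C assms(3,4) unfolding closes_circuit_def by blast
  with w that show ?thesis by (auto simp: maximal_elements_def)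
qed

text \<open>This is all that is used of the recursion for the labels besides monotonicity and positivity.
  The label of \<open>p\<close> exceeds all labels below it when the degree of \<open>p\<close> is at most 1 or \<open>p\<close> closes a circuit.
  Otherwise the label of \<open>p\<close> is the maximum \<open>m\<close> below, and the labels between \<open>m - 1\<close> and \<open>m\<close> form no
  circuit; by monotonicity everything between \<open>x\<close> and \<open>p\<close> has such a label.\<close>

lemma label_cases:
  assumes "filtered P" "p \<in> P"
  obtains (jump) "\<And>s. s \<in> P \<Longrightarrow> s < p \<Longrightarrow> label P s < label P p"
  | (bounded) "\<And>x u v. \<lbrakk>x \<in> P; u \<in> P; v \<in> P; x \<le> u; x \<le> v; u < p; v < p; label P p \<le> Suc (label P x)\<rbrakk>
       \<Longrightarrow> \<exists>w\<in>P. w < p \<and> u \<le> w \<and> v \<le> w"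
proof (cases "degree P p \<le> 1")
  case True
  have "label P s < label P p" if "s \<in> P" "s < p" for s
    using degree_less[OF assms(1) that(1) assms(2) that(2)] label_le_degree[OF assms(1) that(1)]
      label_pos[OF assms(1) that(1) assms(2) that(2)] True by simp
  then show ?thesis by (rule jump)
next
  case False
  let ?m = "Max (label P ` {q \<in> P. q < p})"
  let ?S = "{s \<in> P. s < p \<and> ?m - 1 \<le> label P s \<and> label P s \<le> ?m}"
  have le: "label P s \<le> ?m" if "s \<in> P" "s < p" for s
    using finite_labels_below[OF assms] that by (intro Max_ge) auto
  have eq: "label P p = (if closes_circuit P p ?S then ?m + 1 else ?m)"
    using False by (subst label_eq[OF assms]) (simp add: Let_def)
  show ?thesis
  proof (cases "closes_circuit P p ?S")
    case True
    have "label P s < label P p" if "s \<in> P" "s < p" for s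
      using le[OF that] eq True by simp
    then show ?thesis by (rule jump)
  next
    case no: False
    have "\<exists>w\<in>P. w < p \<and> u \<le> w \<and> v \<le> w"
      if *: "x \<in> P" "u \<in> P" "v \<in> P" "x \<le> u" "x \<le> v" "u < p" "v < p" "label P p \<le> Suc (label P x)"
      for x u v
    proof -
      have "y \<in> ?S" if "y \<in> P" "x \<le> y" "y < p" for y
        using that label_mono[OF assms(1) *(1) that(1,2)] *(8) le[OF that(1,3)] eq no by simp
      then have "x \<in> ?S" "u \<in> ?S" "v \<in> ?S" using * by (auto dest: order.strict_trans1)
      then obtain w where "w \<in> ?S" "u \<le> w" "v \<le> w"
        using not_closes_circuit_bounded[OF assms _ no, of x u v] * by blast
      then show ?thesis by blast
    qed
    then show ?thesis by (rule bounded)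
  qed
qed

text \<open>If \<open>u\<close> and \<open>t\<close> are strictly below \<open>p\<close>, then \<open>p\<close> has the label of \<open>t\<close> below it, so that
  the first alternative of \<open>label_cases\<close> is impossible and the second one replaces \<open>p\<close> by a smaller upper
  bound, which has the same label because it lies between \<open>t\<close> and \<open>p\<close>.\<close>

lemma top_label_comparable:
  assumes "filtered P" "s \<in> P" "u \<in> P" "t \<in> P" "p \<in> P"
    and "s \<le> u" "s \<le> t" "u \<le> p" "t \<le> p" "label P t = label P p" "label P p \<le> Suc (label P s)"
  shows "u \<le> t \<or> t \<le> u"
  using assms(5,8-)
proof (induction "degree P p" arbitrary: p rule: less_induct)
  case less
  show ?case
  proof (cases "u = p \<or> t = p")
    case True
    then show ?thesis using less.prems by auto
  next
    case False
    then have lt: "u < p" "t < p" using less.prems by auto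
    show ?thesis
    proof (cases rule: label_cases[OF assms(1) less.prems(1)])
      case 1
      then show ?thesis using lt assms(4) less.prems(4) by fastforce
    next
      case 2
      then obtain w where w: "w \<in> P" "w < p" "u \<le> w" "t \<le> w"
        using assms(2-4,6,7) lt less.prems(5) by blast
      have "label P w = label P p"
        using label_mono[OF assms(1,4) w(1,4)] label_mono[OF assms(1) w(1) less.prems(1)] w(2)
          less.prems(4) by simp
      then show ?thesis
        using less.hyps[of w] degree_less[OF assms(1) w(1) less.prems(1) w(2)] w less.prems by simp
    qed
  qed
qed

section \<open>The measure of an interval\<close>

abbreviation interval :: "'a::order set \<Rightarrow> 'a \<Rightarrow> 'a \<Rightarrow> 'a set" where
  "interval P q p \<equiv> {x \<in> P. q \<le> x \<and> x \<le> p}"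

text \<open>Once the elements of \<open>R\<close> with high labels are gone, the others can be removed with larger ones
  first.  Above \<open>x\<close> only elements outside \<open>R\<close> are then left, and these have a least element; below
  \<open>x\<close> nothing is missing, since all labels there are low.  This serves the last stage for the interval
  itself and, in the stage before it, for the remainder below an element of the highest label.\<close>

lemma sequence_low_labels:
  assumes "filtered P" "p \<in> P" "strippable (interval P q p) R" "q \<in> R" "label P q \<le> k"
    and IH: "\<And>x. x \<in> R \<Longrightarrow> label P x \<le> k \<Longrightarrow> measure_le k (interval P q x)"
  shows "\<exists>ps. sequence_wrt (measure_le k) (interval P q p - {x \<in> R. k < label P x}) ps"
proof -
  let ?I = "interval P q p - {x \<in> R. k < label P x}"
  let ?A = "{x \<in> R. label P x \<le> k}"
  have R: "R \<subseteq> interval P q p" "finite R" using assms(3) by (auto simp: strippable_def)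
  show ?thesis
  proof (rule sequence_wrt_peel[where A = ?A and before = "\<lambda>x y. y < x" and q = q])
    show "finite ?A" using R by simp
    show "transp (\<lambda>x y::'a. y < x)" "asymp (\<lambda>x y::'a. y < x)"
      by (auto intro: transpI asympI)
    show "initial ?I q" using R assms(4,5) by (auto simp: initial_def)
    show "q \<in> ?A \<or> (\<exists>ps. sequence_wrt (measure_le k) (?I - ?A) ps)"
      using assms(4,5) by simp
    fix x D
    assume x: "x \<in> ?A" "D \<subseteq> ?A - {x}" "\<And>y. y \<in> ?A \<Longrightarrow> x < y \<Longrightarrow> y \<in> D"
      "\<And>y. y \<in> D \<Longrightarrow> \<not> y < x"
    obtain z where z: "least_above (interval P q p - R) x z"
      using assms(3) x(1) unfolding strippable_def by blast
    have "least_above (?I - D) x z"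
      using z x(1-3) by (fastforce simp: least_above_def)
    moreover have "{y \<in> ?I - D. y \<le> x} = interval P q x"
    proof -
      have "label P y \<le> k" if "y \<in> P" "y \<le> x" for y
        using label_mono[OF assms(1) that(1) _ that(2)] x(1) R by (auto dest: order_trans)
      moreover have "y \<notin> D" if "y \<le> x" for y
        using that x(2,4) by (auto simp: order_le_less)
      moreover have "y \<le> p" if "y \<le> x" for y
        using that x(1) R(1) by (auto intro: order_trans)
      ultimately show ?thesis by (auto simp: not_less)
    qed
    ultimately show "removable (measure_le k) (?I - D) x"
      unfolding removable_def using x(1,2) R IH by auto
  qed
qed

lemma strippable_interval_below:
  assumes "strippable (interval P q p) R" "x \<in> interval P q p"
  shows "strippable (interval P q x) {y \<in> R. y < x}"
proof -
  have "{y \<in> interval P q p. y \<le> x} = interval P q x" using assms(2) by auto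
  then show ?thesis using strippable_below[OF assms] by simp
qed

text \<open>Strong induction on \<open>p\<close>, with the three stages described at the beginning.  When \<open>q < p\<close> has
  the label of \<open>p\<close>, the interval is a chain and \<open>q\<close> can go at once; when its label is smaller by 1, the
  first stage reaches it.  The other stages are entered only if the labels differ by at least 2.\<close>

lemma measure_le_label:
  assumes "filtered P" "q \<in> P" "p \<in> P" "q \<le> p"
    and "strippable (interval P q p) R" "q \<in> R \<or> q = p"
  shows "measure_le (label P p) (interval P q p)"
  using assms(3-)
proof (induction "degree P p" arbitrary: p R rule: less_induct)
  case less
  have singleton: "measure_le n (interval P q q)" for n
  proof -
    have "interval P q q = {q}" using assms(2) by auto
    then show ?thesis using measure_le_mono[of 0 "{q}" n] by simp
  qed
  show ?case
  proof (cases "q = p")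
    case True
    then show ?thesis using singleton by simp
  next
    case False
    then have q: "q \<in> R" "q < p" using less.prems by auto
    let ?I = "interval P q p" and ?B = "label P"
    \<comment> \<open>From here on \<open>label P p = Suc n\<close>, so the stages remove the labels \<open>n\<close>, then \<open>Suc n\<close>, then those below \<open>n\<close>.\<close>
    obtain n where n: "label P p = Suc n"
      using label_pos[OF assms(1,2) less.prems(1) q(2)] gr0_implies_Suc by blast
    have R: "R \<subseteq> ?I" "finite R" using less.prems(3) by (auto simp: strippable_def)
    have least: "\<exists>z. least_above (?I - R) x z" if "x \<in> R" for x
      using less.prems(3) that by (auto simp: strippable_def)
    have p: "p \<notin> R" using least by (fastforce simp: least_above_def)
    have lt: "x < p" if "x \<in> R" for x using that R p by (auto simp: order_le_less)
    have IH: "measure_le (?B x) (interval P q x)" if "x \<in> R" for x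
    proof (rule less.hyps)
      show "degree P x < degree P p"
        using degree_less[OF assms(1)] that R lt less.prems(1) by auto
      show "strippable (interval P q x) {y \<in> R. y < x}"
        using strippable_interval_below[OF less.prems(3)] that R by blast
    qed (use that R q in auto)
    have le: "?B y \<le> Suc n" if "y \<in> ?I" for y
      using label_mono[OF assms(1) _ less.prems(1)] that n by fastforce
    have comparable: "u \<le> t \<or> t \<le> u"
      if "s \<in> ?I" "u \<in> ?I" "t \<in> ?I" "s \<le> u" "s \<le> t" "?B t = Suc n" "n \<le> ?B s" for s u t
      using top_label_comparable[OF assms(1), of s u t p] that less.prems(1) n by simp
    have above: "?B s \<le> ?B y" if "s \<in> ?I" "y \<in> ?I" "s < y" for s y
      using label_mono[OF assms(1)] that by (simp add: less_imp_le)
    have filt: "filtered (?I - D)" for D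
      by (rule filtered_subset[OF assms(1)]) auto
    have top_chain: "\<exists>z. least_above (?I - D) x z" if x: "x \<in> ?I" "?B x = Suc n" "x < p" "p \<notin> D" for x D
    proof -
      have top: "?B y = Suc n" if "y \<in> ?I" "x < y" for y
        using above[OF x(1) that] le[OF that(1)] x(2) by simp
      have "u \<le> v \<or> v \<le> u" if "u \<in> ?I - D" "v \<in> ?I - D" "x < u" "x < v" for u v
        using comparable[OF x(1), of u v] top that x(2) by (auto simp: less_imp_le)
      moreover have "p \<in> ?I - D" using x less.prems by simp
      ultimately show ?thesis using least_above_of_chain[OF filt _ x(3)] by blast
    qed
    have init: "initial ?I q" using q assms(2) by (auto simp: initial_def)
    have "\<exists>ps. sequence_wrt (measure_le n) ?I ps"
    proof (cases "?B q = Suc n")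
      case True
      have "\<exists>z. least_above (?I - {}) q z"
        by (rule top_chain) (use True q assms(2) in auto)
      then have "\<exists>z. least_above ?I q z" by simp
      moreover have "{y \<in> ?I. y \<le> q} = interval P q q"
        using q(2) by (auto intro: order_trans less_imp_le)
      then have "measure_le n {y \<in> ?I. y \<le> q}" by (simp only: singleton)
      moreover have "q \<in> ?I" using q(1) R(1) by blast
      ultimately have "removable (measure_le n) ?I q"
        unfolding removable_def by (intro conjI)
      then show ?thesis using sequence_wrt_Cons[OF init] by blast
    next
      case False
      let ?A = "{x \<in> R. ?B x = n}" and ?T = "{x \<in> R. ?B x = Suc n}"
      have "q \<in> ?A \<or> (\<exists>ps. sequence_wrt (measure_le n) (?I - ?A) ps)"
      proof (cases "?B q = n")
        case True
        then show ?thesis using q by simp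
      next
        case qn: False
        then have "?B q < n" using False le[of q] q R by fastforce
        then obtain k where k: "n = Suc k" "?B q \<le> k" by (cases n) auto
        have low: "\<exists>ps. sequence_wrt (measure_le k)
            (interval P q t - {x \<in> {y \<in> R. y < t}. k < ?B x}) ps"
          if t: "t \<in> ?I" "q < t" for t
        proof (rule sequence_low_labels[OF assms(1)])
          show "strippable (interval P q t) {y \<in> R. y < t}"
            using strippable_interval_below[OF less.prems(3) t(1)] .
          show "measure_le k (interval P q x)" if "x \<in> {y \<in> R. y < t}" "?B x \<le> k" for x
            using measure_le_mono[OF IH] that by blast
        qed (use t q k in auto)
        have "\<exists>ps. sequence_wrt (measure_le n) (?I - ?A) ps"
        proof (rule sequence_wrt_peel[where A = ?T and before = "(<)" and q = q])
          show "finite ?T" using R by simp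
          show "initial (?I - ?A) q" using init qn by (auto simp: initial_def)
          have "{x \<in> {y \<in> R. y < p}. k < ?B x} = ?A \<union> ?T"
            using le k R lt by fastforce
          then have "\<exists>ps. sequence_wrt (measure_le k) (?I - ?A - ?T) ps"
            using low[of p] less.prems q by (simp add: Diff_Un Diff_Diff_Int set_diff_eq conj_assoc)
          then show "q \<in> ?T \<or> (\<exists>ps. sequence_wrt (measure_le n) (?I - ?A - ?T) ps)"
            using sequence_wrt_mono[of "measure_le k" _ _ "measure_le n"] k(1) by fastforce
          fix t D
          assume t: "t \<in> ?T" "D \<subseteq> ?T - {t}" "\<And>y. y \<in> ?T \<Longrightarrow> y < t \<Longrightarrow> y \<in> D"
            "\<And>y. y \<in> D \<Longrightarrow> \<not> t < y"
          have tI: "t \<in> ?I" "t < p" using t(1) R lt by auto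
          moreover have "q \<noteq> t" using t(1) \<open>?B q \<noteq> Suc n\<close> by auto
          ultimately have "q < t" by (simp add: order_le_less)
          have "\<exists>z. least_above (?I - (?A \<union> D)) t z"
            by (rule top_chain) (use t tI p in auto)
          then have "\<exists>z. least_above (?I - ?A - D) t z" by (simp only: Diff_eq Compl_Un Int_assoc)
          moreover have "{y \<in> ?I - ?A - D. y \<le> t} =
              interval P q t - {x \<in> {y \<in> R. y < t}. k < ?B x}"
          proof -
            have "k < ?B x \<longleftrightarrow> ?B x = n \<or> ?B x = Suc n" if "x \<in> R" for x
              using that le R k(1) by fastforce
            then show ?thesis using t tI by (auto simp: order_le_less dest: order_trans)
          qed
          then have "measure_le n {y \<in> ?I - ?A - D. y \<le> t}"
            using low[OF tI(1) \<open>q < t\<close>] k(1) by simp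
          moreover have "t \<in> ?I - ?A - D" using t(1,2) tI by auto
          ultimately show "removable (measure_le n) (?I - ?A - D) t"
            unfolding removable_def by (intro conjI)
        qed (auto intro: transpI asympI)
        then show ?thesis ..
      qed
      then show ?thesis
      proof (rule sequence_wrt_peel[where A = ?A and before = "\<lambda>x y. y < x" and q = q, rotated -1])
        show "finite ?A" using R by simp
        show "transp (\<lambda>x y::'a. y < x)" "asymp (\<lambda>x y::'a. y < x)"
          by (auto intro: transpI asympI)
        show "initial ?I q" by (rule init)
        fix s D
        assume s: "s \<in> ?A" "D \<subseteq> ?A - {s}" "\<And>y. y \<in> ?A \<Longrightarrow> s < y \<Longrightarrow> y \<in> D"
          "\<And>y. y \<in> D \<Longrightarrow> \<not> y < s"
        have sI: "s \<in> ?I" "s < p" using s(1) R lt by auto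
        have "\<exists>z. least_above (?I - D) s z"
        proof -
          obtain z where z: "least_above (?I - R) s z" using least s(1) by blast
          have zI: "z \<in> ?I" "z \<notin> R" "s < z" using z by (auto simp: least_above_def)
          \<comment> \<open>Elements of \<open>R\<close> of label \<open>n\<close> above \<open>s\<close> are gone, and outside \<open>R\<close> labels are at least that of \<open>z\<close>.\<close>
          have top: "?B y = Suc n" if "y \<in> ?I - D" "s < y" "y \<in> R \<or> ?B z = Suc n" for y
          proof -
            have "?B y = n \<or> ?B y = Suc n" using above[OF sI(1)] le s(1) that by fastforce
            moreover have "?B z \<le> ?B y" if "y \<notin> R"
              using z label_mono[OF assms(1)] \<open>y \<in> ?I - D\<close> \<open>s < y\<close> that
              by (auto simp: least_above_def)
            ultimately show ?thesis using that s(3)[of y] by fastforce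
          qed
          show ?thesis
          proof (cases "?B z = Suc n")
            case True
            have "u \<le> v \<or> v \<le> u" if "u \<in> ?I - D" "v \<in> ?I - D" "s < u" "s < v" for u v
              using comparable[OF sI(1), of u v] top that True s(1) by (auto simp: less_imp_le)
            moreover have "p \<in> ?I - D" using p s(2) less.prems by auto
            ultimately show ?thesis using least_above_of_chain[OF filt _ sI(2)] by blast
          next
            case no: False
            \<comment> \<open>Now \<open>z\<close> has label \<open>n\<close>, so an element of the top label comparable to \<open>z\<close> lies above it.\<close>
            have "z \<le> y" if y: "y \<in> ?I - D" "s < y" for y
            proof (cases "y \<in> R")
              case True
              then have "?B y = Suc n" using top y by blast
              then have "z \<le> y \<or> y \<le> z"
                using comparable[OF sI(1), of z y] zI y s(1) by (auto simp: less_imp_le)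
              moreover have "\<not> y < z" using above[of y z] y zI no le[of z] \<open>?B y = Suc n\<close> by fastforce
              ultimately show ?thesis by auto
            next
              case False
              then show ?thesis using z y by (auto simp: least_above_def)
            qed
            then show ?thesis using zI s(2) by (auto simp: least_above_def intro!: exI[of _ z])
          qed
        qed
        moreover have "{y \<in> ?I - D. y \<le> s} = interval P q s"
          using s sI by (auto simp: order_le_less dest: order_trans)
        ultimately show "removable (measure_le n) (?I - D) s"
          unfolding removable_def using s sI IH[of s] by auto
      qed
    qed
    then show ?thesis using n by simp
  qed
qed

lemma measure_le_strippable:
  assumes "filtered P" "q \<in> P" "p \<in> P" "q \<le> p" "measure_le N (interval P q p)"
  obtains R where "strippable (interval P q p) R" "q \<in> R \<or> q = p"
proof -
  have init: "initial (interval P q p) q" using assms by (auto simp: initial_def)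
  have filt: "filtered (interval P q p)" by (rule filtered_subset[OF assms(1)]) auto
  consider "is_singleton (interval P q p)" | k ps where "n_sequence k (interval P q p) ps"
    using assms(5) measure_le_iff_n_sequence by blast
  then show ?thesis
  proof cases
    case 1
    moreover have "q \<in> interval P q p" "p \<in> interval P q p" using assms by auto
    ultimately have "q = p" by (metis is_singletonE singletonD)
    then show ?thesis using that[of "{}"] by (simp add: strippable_def)
  next
    case 2
    then have "strippable (interval P q p) (set ps)" "ps \<noteq> []" "initial (interval P q p) (last ps)"
      using removal_list_strippable[OF filt] by (auto simp: n_sequence_def sequence_wrt_def)
    moreover from this(3) have "last ps = q"
      using init unfolding initial_def by (metis order_antisym)
    ultimately show ?thesis using that by (metis last_in_set)
  qed
qed

theorem theorem3p9:
  fixes P :: "'a::order set"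
  assumes "filtered P"
  shows "delta P \<le> (SUP p\<in>P. enat (label P p))"
  unfolding delta_def
proof (rule Sup_least)
  fix l
  assume "l \<in> {poset_measure (interval P q p) | q p.
    q \<in> P \<and> p \<in> P \<and> q \<le> p \<and> poset_measure (interval P q p) \<noteq> \<infinity>}"
  then obtain q p where l: "l = poset_measure (interval P q p)"
    and *: "q \<in> P" "p \<in> P" "q \<le> p" "poset_measure (interval P q p) \<noteq> \<infinity>"
    by blast
  from *(4) obtain N where "poset_measure (interval P q p) = enat N" by blast
  then have "measure_le N (interval P q p)" by (metis order_refl poset_measure_le_iff)
  then obtain R where "strippable (interval P q p) R" "q \<in> R \<or> q = p"
    using measure_le_strippable[OF assms *(1-3)] by blast
  then have "measure_le (label P p) (interval P q p)"
    by (rule measure_le_label[OF assms *(1-3)])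
  then have "poset_measure (interval P q p) \<le> enat (label P p)"
    by (simp add: poset_measure_le_iff)
  also have "\<dots> \<le> (SUP p\<in>P. enat (label P p))" using *(2) by (rule SUP_upper)
  finally show "l \<le> (SUP p\<in>P. enat (label P p))" by (simp add: l)
qed

end
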